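(* Let $W_{p,n}(\boldsymbol\delta_\phi)$ be the solution of the equation $$\frac{1+W}{a(W)}=\frac{p(n+p+2)}{n}\cdot\frac{1}{\alpha_{p,n}(\boldsymbol\delta_\phi)}.$$ Define $\psi_1(W)$ by $$\psi_1(W)=\min\left(1,\ \frac np\cdot\frac{1+W_{p,n}(\boldsymbol\delta_\phi)}{n+p+2}\cdot\frac{\alpha_{p,n}(\boldsymbol\delta_\phi)}{a(W)}\right).$$ Then $\hat R^*(\psi_1;\boldsymbol\delta_\phi)=\frac{pS}{n}a(W)\psi_1(W)$ improves on $\hat R^*_0(\boldsymbol\delta_\phi)=\frac{pS}{n}a(W)$, as an estimator of $R^*(\boldsymbol\delta_\phi)$, under the loss $L(\hat R^*;R^*(\boldsymbol\delta_\phi))=(\hat R^*-R^*(\boldsymbol\delta_\phi))^2$.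
   Context: Let $p\ge 3$, and let $\boldsymbol X\sim N_p(\boldsymbol\theta,\sigma^2 I_p)$ and $S\sim\sigma^2\chi^2_n$ be independent, where $\boldsymbol\theta$ and $\sigma^2$ are both unknown and $\chi^2_n$ is a chi-square variable with $n$ degrees of freedom. Put $W=\|\boldsymbol X\|^2/S$ and $\lambda=\|\boldsymbol\theta\|^2/\sigma^2$. Consider a shrinkage estimator $\boldsymbol\delta_\phi=\left(1-\frac{\phi(W)}{W}\right)\boldsymbol X$ of $\boldsymbol\theta$ which improves on $\boldsymbol X$ under squared error loss, where $\phi(\cdot)$ and $\phi'(\cdot)$ are assumed to be finite. Its mean squared error is $R(\boldsymbol\delta_\phi)=E\|\boldsymbol\delta_\phi-\boldsymbol\theta\|^2$; since $\boldsymbol\delta_\phi$ improves on $\boldsymbol X$, $R(\boldsymbol\delta_\phi)\le p\sigma^2$. Let $\hat R_0(\boldsymbol\delta_\phi)$ denote the uniformly minimum variance unbiased estimator of $R(\boldsymbol\delta_\phi)$. When $\phi$ and $\phi'$ are continuous it is expressed by $$\hat R_0(\boldsymbol\delta_\phi)=\frac{pS}{n}-S\,g(W)+\frac{S\phi^2(W)}{W},\qquad g(W)=W^{n/2}\int_W^\infty t^{-n/2}\,\frac{h(t)}{t}\,dt,\qquad h(W)=(p-2)\frac{\phi(W)}{W}+2\phi'(W).$$ Set $a(W)=\frac np\left(g(W)-\frac{\phi^2(W)}{W}\right)$, so that $\hat R_0(\boldsymbol\delta_\phi)=\frac{pS}{n}(1-a(W))$. The risk reduction is $R^*(\boldsymbol\delta_\phi)=p\sigma^2-R(\boldsymbol\delta_\phi)$;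 its uniformly minimum variance unbiased estimator is $\hat R^*_0(\boldsymbol\delta_\phi)=\frac{pS}{n}a(W)$. The ratio $R^*(\boldsymbol\delta_\phi)/\sigma^2$ depends only on $\lambda$; it is supposed to be maximized at $\lambda=0$, and $\alpha_{p,n}(\boldsymbol\delta_\phi)$ denotes its value at $\lambda=0$. "Improves on" under a loss refers to comparison of risks (expected losses).
   Formalization: Two hypotheses are added: a(W) does not exceed a(W_{p,n}) for W > W_{p,n} (the claim can fail when a rises beyond the solution), and ψ_1 is not identically 1 (otherwise the two estimators coincide and neither strictly improves on the other). *)

theory Defs
  imports "HOL-Probability.Probability"
begin

text \<open>
  The sample space is \<open>(real^'p) \<times> real\<close>, a sample point being \<open>(x, s)\<close>, and the dimension is
  \<open>CARD('p)\<close>. The parameter is \<open>(\<theta>, \<sigma>)\<close>, where \<open>\<sigma> > 0\<close> stands for the unknown variance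
  \<open>\<sigma>\<^sup>2\<close>. Estimators are functions of the sample point and do not depend on the parameter.
\<close>

text \<open>The law \<open>N\<^sub>p(\<theta>, \<sigma>\<^sup>2 I)\<close>.\<close>

definition mvnormal :: "real^'p \<Rightarrow> real \<Rightarrow> (real^'p) measure" where
  "mvnormal \<theta> \<sigma> =
     density lborel (\<lambda>x. ennreal (exp (- (norm (x - \<theta>))\<^sup>2 / (2 * \<sigma>\<^sup>2)) / sqrt (2 * pi * \<sigma>\<^sup>2) ^ CARD('p)))"

definition chi_square :: "nat \<Rightarrow> real measure" where
  "chi_square n =
     density lborel (\<lambda>s. ennreal
       (if 0 < s then s powr (real n / 2 - 1) * exp (- s / 2) / (2 powr (real n / 2) * Gamma (real n / 2)) else 0))"

text \<open>The joint law of the independent pair \<open>X \<sim> N\<^sub>p(\<theta>, \<sigma>\<^sup>2 I)\<close>, \<open>S \<sim> \<sigma>\<^sup>2 \<chi>\<^sup>2\<^sub>n\<close>.\<close>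

definition sample_law :: "nat \<Rightarrow> real^'p \<Rightarrow> real \<Rightarrow> ((real^'p) \<times> real) measure" where
  "sample_law n \<theta> \<sigma> = mvnormal \<theta> \<sigma> \<Otimes>\<^sub>M distr (chi_square n) borel (\<lambda>s. \<sigma>\<^sup>2 * s)"

text \<open>
  Risks are nonnegative integrals with values in \<open>[0, \<infinity>]\<close>. This matters: for small \<open>p\<close> the unbiased
  estimator of the risk reduction can have infinite mean squared error (for \<open>p = 3, 4\<close> and constant
  \<open>\<phi>\<close>, for example), and a Bochner integral would then return 0.
\<close>

definition mse :: "nat \<Rightarrow> ((real^'p) \<times> real \<Rightarrow> real^'p) \<Rightarrow> real^'p \<Rightarrow> real \<Rightarrow> ennreal" where
  "mse n \<delta> \<theta> \<sigma> = (\<integral>\<^sup>+ z. ennreal ((norm (\<delta> z - \<theta>))\<^sup>2) \<partial>sample_law n \<theta> \<sigma>)"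

text \<open>
  The risk reduction \<open>R\<^sup>* = p \<sigma>\<^sup>2 - R\<close>. It is meaningful for \<open>\<delta>\<close> of finite risk, in particular
  whenever \<open>\<delta>\<close> improves on \<open>X\<close>.
\<close>

definition risk_reduction :: "nat \<Rightarrow> ((real^'p) \<times> real \<Rightarrow> real^'p) \<Rightarrow> real^'p \<Rightarrow> real \<Rightarrow> real" where
  "risk_reduction n \<delta> \<theta> \<sigma> = real CARD('p) * \<sigma>\<^sup>2 - enn2real (mse n \<delta> \<theta> \<sigma>)"

text \<open>
  The value of \<open>R\<^sup>*/\<sigma>\<^sup>2\<close> at \<open>\<lambda> = \<parallel>\<theta>\<parallel>\<^sup>2/\<sigma>\<^sup>2 = 0\<close>. For a shrinkage estimator (as defined below) this
  ratio depends on \<open>(\<theta>, \<sigma>)\<close> only through \<open>\<lambda>\<close>, so it may be taken at \<open>\<theta> = 0\<close>, \<open>\<sigma> = 1\<close>.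
\<close>

definition alpha :: "nat \<Rightarrow> ((real^'p) \<times> real \<Rightarrow> real^'p) \<Rightarrow> real" where
  "alpha n \<delta> = risk_reduction n \<delta> 0 1 / 1\<^sup>2"

definition risk_of_reduction_estimator ::
  "nat \<Rightarrow> ((real^'p) \<times> real \<Rightarrow> real^'p) \<Rightarrow> ((real^'p) \<times> real \<Rightarrow> real) \<Rightarrow> real^'p \<Rightarrow> real \<Rightarrow> ennreal" where
  "risk_of_reduction_estimator n \<delta> T \<theta> \<sigma> =
     (\<integral>\<^sup>+ z. ennreal ((T z - risk_reduction n \<delta> \<theta> \<sigma>)\<^sup>2) \<partial>sample_law n \<theta> \<sigma>)"

text \<open>
  Improvement in the usual decision-theoretic sense, for two risk functions of \<open>(\<theta>, \<sigma>)\<close>: never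
  larger, and smaller for at least one parameter value.
\<close>

definition improves_on :: "(real^'p \<Rightarrow> real \<Rightarrow> ennreal) \<Rightarrow> (real^'p \<Rightarrow> real \<Rightarrow> ennreal) \<Rightarrow> bool" where
  "improves_on R R' \<longleftrightarrow>
     (\<forall>\<theta> \<sigma>. 0 < \<sigma> \<longrightarrow> R \<theta> \<sigma> \<le> R' \<theta> \<sigma>) \<and> (\<exists>\<theta> \<sigma>. 0 < \<sigma> \<and> R \<theta> \<sigma> < R' \<theta> \<sigma>)"

text \<open>
  \<open>S > 0\<close> and \<open>X \<noteq> 0\<close> hold almost surely, so only the values of the functions below at \<open>w > 0\<close> matter.
\<close>

definition W_stat :: "(real^'p) \<times> real \<Rightarrow> real" where
  "W_stat z = (norm (fst z))\<^sup>2 / snd z"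

definition shrinkage :: "(real \<Rightarrow> real) \<Rightarrow> (real^'p) \<times> real \<Rightarrow> real^'p" where
  "shrinkage \<phi> z = (1 - \<phi> (W_stat z) / W_stat z) *\<^sub>R fst z"

definition h_fun :: "nat \<Rightarrow> (real \<Rightarrow> real) \<Rightarrow> real \<Rightarrow> real" where
  "h_fun p \<phi> w = (real p - 2) * (\<phi> w / w) + 2 * deriv \<phi> w"

text \<open>The gauge integral over \<open>{w..}\<close> includes the improper integral up to infinity.\<close>

definition g_integrand :: "nat \<Rightarrow> nat \<Rightarrow> (real \<Rightarrow> real) \<Rightarrow> real \<Rightarrow> real" where
  "g_integrand p n \<phi> t = t powr (- (real n / 2)) * (h_fun p \<phi> t / t)"

definition g_fun :: "nat \<Rightarrow> nat \<Rightarrow> (real \<Rightarrow> real) \<Rightarrow> real \<Rightarrow> real" where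
  "g_fun p n \<phi> w = w powr (real n / 2) * integral {w..} (g_integrand p n \<phi>)"

definition a_fun :: "nat \<Rightarrow> nat \<Rightarrow> (real \<Rightarrow> real) \<Rightarrow> real \<Rightarrow> real" where
  "a_fun p n \<phi> w = real n / real p * (g_fun p n \<phi> w - (\<phi> w)\<^sup>2 / w)"

text \<open>
  The unbiased estimator \<open>(p S / n) a(W)\<close> of the risk reduction, and its modification by a factor
  \<open>\<psi>(W)\<close>.
\<close>

definition reduction_est0 :: "nat \<Rightarrow> (real \<Rightarrow> real) \<Rightarrow> (real^'p) \<times> real \<Rightarrow> real" where
  "reduction_est0 n \<phi> z = real CARD('p) * snd z / real n * a_fun (CARD('p)) n \<phi> (W_stat z)"

definition reduction_est ::
  "nat \<Rightarrow> (real \<Rightarrow> real) \<Rightarrow> (real \<Rightarrow> real) \<Rightarrow> (real^'p) \<times> real \<Rightarrow> real" where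
  "reduction_est n \<phi> \<psi> z =
     real CARD('p) * snd z / real n * a_fun (CARD('p)) n \<phi> (W_stat z) * \<psi> (W_stat z)"

text \<open>
  In the two definitions below \<open>\<alpha>\<close> is the value \<open>alpha n \<delta>\<close> for the shrinkage estimator \<open>\<delta>\<close>, and
  \<open>w0\<close> is the solution of the equation that defines \<open>W\<^sub>p\<^sub>,\<^sub>n\<close>. The statistic \<open>W\<close> takes values in
  \<open>(0, \<infinity>)\<close>, and the equation is solved in this range.
\<close>

definition solves_W_equation ::
  "nat \<Rightarrow> nat \<Rightarrow> (real \<Rightarrow> real) \<Rightarrow> real \<Rightarrow> real \<Rightarrow> bool" where
  "solves_W_equation p n \<phi> \<alpha> w0 \<longleftrightarrow>
     0 < w0 \<and> (1 + w0) / a_fun p n \<phi> w0 = real (p * (n + p + 2)) / real n * (1 / \<alpha>)"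

definition psi1 :: "nat \<Rightarrow> nat \<Rightarrow> (real \<Rightarrow> real) \<Rightarrow> real \<Rightarrow> real \<Rightarrow> real \<Rightarrow> real" where
  "psi1 p n \<phi> \<alpha> w0 w =
     min 1 (real n / real p * ((1 + w0) / real (n + p + 2)) * (\<alpha> / a_fun p n \<phi> w))"

end

theory Submission
  imports Defs
begin

text \<open>
  Write \<open>a0 = a(W\<^sub>p\<^sub>,\<^sub>n)\<close>. The equation defining \<open>W\<^sub>p\<^sub>,\<^sub>n\<close> says \<open>a \<psi>\<^sub>1 = min a a0\<close>, so with
  \<open>c0 = (p/n) a0\<close> and \<open>b = (p/n) a\<close> the claim compares \<open>T1 = S min(b(W), c0)\<close> with \<open>T0 = S b(W)\<close>, and the
  two differ only where \<open>W \<le> W\<^sub>p\<^sub>,\<^sub>n\<close>. The stronger inequality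
  \<open>E(T1 - R)\<^sup>2 + E(T0 - T1)\<^sup>2 \<le> E(T0 - R)\<^sup>2\<close> holds, that is, \<open>E (T0 - T1) (T1 - R) \<ge> 0\<close>.
  Substitute \<open>x = \<sigma> \<surd>t y\<close>, \<open>s = \<sigma>\<^sup>2 t\<close>, so that \<open>W = \<parallel>y\<parallel>\<^sup>2\<close>, and average over \<open>\<plusminus>y\<close>: for fixed \<open>y\<close> the variable
  \<open>t\<close> has a gamma density times \<open>cosh (\<surd>t y\<cdot>\<theta>/\<sigma>)\<close>, which increases in \<open>t\<close>. Where \<open>T1 \<noteq> T0\<close>,
  \<open>T1 - R \<ge> c0 \<sigma>\<^sup>2 (t - t1)\<close> with \<open>t1 = (n + p + 2) / (1 + W\<^sub>p\<^sub>,\<^sub>n)\<close>, because \<open>R \<le> \<alpha> \<sigma>\<^sup>2 = c0 \<sigma>\<^sup>2 t1\<close>. As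
  \<open>(t - t1) cosh (\<surd>t c) \<ge> (t - t1) cosh (\<surd>t1 c)\<close>, only a ratio of two gamma moments remains to be compared
  with \<open>t1\<close>. The inequality is strict because \<open>T1\<close> has finite mean squared error and \<open>a > a0\<close> on a
  nonempty open set.
\<close>

section \<open>Densities of the sample law and their moments\<close>

definition chi_dens :: "nat \<Rightarrow> real \<Rightarrow> real" where
  "chi_dens n t =
     (if 0 < t then t powr (real n / 2 - 1) * exp (- t / 2) / (2 powr (real n / 2) * Gamma (real n / 2)) else 0)"

definition mvn_dens :: "real^'p \<Rightarrow> real \<Rightarrow> real^'p \<Rightarrow> real" where
  "mvn_dens \<theta> \<sigma> x = exp (- (norm (x - \<theta>))\<^sup>2 / (2 * \<sigma>\<^sup>2)) / sqrt (2 * pi * \<sigma>\<^sup>2) ^ CARD('p)"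

lemma chi_square_eq_density: "chi_square n = density lborel (chi_dens n)"
  by (simp add: chi_square_def chi_dens_def)

lemma mvnormal_eq_density: "mvnormal \<theta> \<sigma> = density lborel (mvn_dens \<theta> \<sigma>)"
  by (simp add: mvnormal_def mvn_dens_def)

lemma chi_dens_measurable [measurable]: "chi_dens n \<in> borel_measurable borel"
  unfolding chi_dens_def by measurable

lemma mvn_dens_measurable [measurable]: "mvn_dens \<theta> \<sigma> \<in> borel_measurable borel"
  unfolding mvn_dens_def by measurable

lemma chi_dens_nonneg: "1 \<le> n \<Longrightarrow> 0 \<le> chi_dens n t"
  by (simp add: chi_dens_def Gamma_real_nonneg)

lemma mvn_dens_nonneg: "0 \<le> mvn_dens \<theta> \<sigma> x"
  by (simp add: mvn_dens_def)

text \<open>Euler's integral for \<open>Gamma q\<close> after rescaling the variable by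
  \<open>\<beta>\<close>.\<close>

lemma nn_integral_gamma_density:
  assumes "0 < q" "0 < \<beta>"
  shows "(\<integral>\<^sup>+ t. ennreal (if 0 < t then t powr (q - 1) * exp (- \<beta> * t) else 0) \<partial>lborel)
         = ennreal (Gamma q / \<beta> powr q)"
proof -
  let ?I = "\<integral>\<^sup>+ t. ennreal (if 0 < t then t powr (q - 1) * exp (- \<beta> * t) else 0) \<partial>lborel"
  have "ennreal (Gamma q) = \<integral>\<^sup>+ t. ennreal (indicator {0..} t * t powr (q - 1) / exp t) \<partial>lborel"
    using assms by (intro Gamma_conv_nn_integral_real) simp
  also have "\<dots> = \<bar>\<beta>\<bar> * (\<integral>\<^sup>+ t. ennreal (indicator {0..} (0 + \<beta> * t) * (0 + \<beta> * t) powr (q - 1) / exp (0 + \<beta> * t)) \<partial>lborel)"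
    using assms by (intro nn_integral_real_affine) auto
  also have "(\<lambda>t. ennreal (indicator {0..} (0 + \<beta> * t) * (0 + \<beta> * t) powr (q - 1) / exp (0 + \<beta> * t)))
     = (\<lambda>t. ennreal (\<beta> powr (q - 1)) * ennreal (if 0 < t then t powr (q - 1) * exp (- \<beta> * t) else 0))"
    using assms
    by (intro ext) (auto simp: ennreal_mult[symmetric] powr_mult exp_minus field_simps indicator_def
        zero_le_mult_iff)
  also have "\<bar>\<beta>\<bar> * (\<integral>\<^sup>+ t. ennreal (\<beta> powr (q - 1)) * ennreal (if 0 < t then t powr (q - 1) * exp (- \<beta> * t) else 0) \<partial>lborel)
     = ennreal (\<beta> powr q) * ?I"
    using assms
    by (subst nn_integral_cmult) (auto simp: mult.assoc[symmetric] ennreal_mult[symmetric] powr_diff)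
  finally have eq: "ennreal (Gamma q) = ennreal (\<beta> powr q) * ?I" .
  have "?I = ennreal (1 / \<beta> powr q) * (ennreal (\<beta> powr q) * ?I)"
    using assms by (simp add: mult.assoc[symmetric] ennreal_mult[symmetric])
  also have "\<dots> = ennreal (Gamma q / \<beta> powr q)"
    using assms by (simp add: eq[symmetric] ennreal_mult[symmetric])
  finally show ?thesis .
qed

text \<open>The factor \<open>t ^ k\<close> only raises the gamma shape from \<open>n / 2\<close> to
  \<open>n / 2 + k\<close>, at rate \<open>1/2\<close>. Exponent 0 yields the total mass, exponent 2
  the second moment.\<close>

lemma nn_integral_chi_dens_power:
  assumes "1 \<le> n"
  shows "(\<integral>\<^sup>+ t. ennreal (t ^ k * chi_dens n t) \<partial>lborel)
         = ennreal (2 ^ k * Gamma (real n / 2 + real k) / Gamma (real n / 2))"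
proof -
  let ?q = "real n / 2 + real k" and ?C = "1 / (2 powr (real n / 2) * Gamma (real n / 2))"
  have G: "0 < Gamma (real n / 2)"
    using assms by (intro Gamma_real_pos) auto
  have "t ^ k * chi_dens n t = ?C * (if 0 < t then t powr (?q - 1) * exp (- (1/2) * t) else 0)" for t
  proof -
    have "t powr (?q - 1) = t ^ k * t powr (real n / 2 - 1)" if "0 < t"
    proof -
      have "t powr (?q - 1) = t powr (real k + (real n / 2 - 1))"
        by (rule arg_cong[where f="\<lambda>u. t powr u"]) simp
      also have "\<dots> = t ^ k * t powr (real n / 2 - 1)"
        using that by (simp only: powr_add powr_realpow)
      finally show ?thesis .
    qed
    then show ?thesis
      by (simp add: chi_dens_def)
  qed
  then have "(\<integral>\<^sup>+ t. ennreal (t ^ k * chi_dens n t) \<partial>lborel)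
      = (\<integral>\<^sup>+ t. ennreal ?C * ennreal (if 0 < t then t powr (?q - 1) * exp (- (1/2) * t) else 0) \<partial>lborel)"
    using G by (simp only: ennreal_mult'[of ?C] zero_le_divide_1_iff less_imp_le powr_ge_zero mult_nonneg_nonneg)
  also have "\<dots> = ennreal ?C * ennreal (Gamma ?q / (1/2) powr ?q)"
    using assms by (subst nn_integral_cmult) (auto simp: nn_integral_gamma_density)
  also have "\<dots> = ennreal (2 ^ k * Gamma ?q / Gamma (real n / 2))"
  proof -
    have "(1/2) powr ?q = 1 / ((2 powr (real n / 2)) * 2 ^ k)"
      by (simp only: powr_divide powr_add powr_realpow zero_less_numeral powr_one_eq_one times_divide_times_eq mult_1)
    then have "?C * (Gamma ?q / (1/2) powr ?q) = 2 ^ k * Gamma ?q / Gamma (real n / 2)"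
      by simp
    moreover have "0 \<le> ?C"
      using G by simp
    ultimately show ?thesis
      by (metis ennreal_mult')
  qed
  finally show ?thesis .
qed

lemma prob_space_chi_square:
  assumes "1 \<le> n"
  shows "prob_space (chi_square n)"
proof
  have "0 < real n / 2"
    using assms by simp
  from Gamma_real_pos[OF this] have "Gamma (real n / 2) \<noteq> 0"
    by simp
  then show "emeasure (chi_square n) (space (chi_square n)) = 1"
    using nn_integral_chi_dens_power[OF assms, of 0]
    by (simp add: chi_square_eq_density emeasure_density)
qed

lemma norm_diff_square_eq_sum:
  fixes x :: "'a::euclidean_space"
  shows "(norm (x - y))\<^sup>2 = (\<Sum>b\<in>Basis. (x \<bullet> b - y \<bullet> b)\<^sup>2)"
  by (subst norm_eq_sqrt_inner, subst euclidean_inner)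
    (simp add: sum_nonneg inner_diff_left power2_eq_square)

text \<open>The squared norm is a sum over coordinates, so its exponential factors. Integrals then
  reduce to one-dimensional ones.\<close>

lemma mvn_dens_eq_prod:
  fixes \<theta> :: "real^'p"
  assumes "0 < \<sigma>"
  shows "mvn_dens \<theta> \<sigma> x = (\<Prod>b\<in>Basis. normal_density (\<theta> \<bullet> b) \<sigma> (x \<bullet> b))"
proof -
  show ?thesis
    unfolding mvn_dens_def norm_diff_square_eq_sum normal_density_def
    by (simp add: prod.distrib prod_dividef exp_sum[symmetric] sum_divide_distrib sum_negf power_one_over)
qed

lemma nn_integral_normal_density: "0 < \<sigma> \<Longrightarrow> (\<integral>\<^sup>+ x. ennreal (normal_density \<mu> \<sigma> x) \<partial>lborel) = 1"
  by (subst nn_integral_eq_integral) (auto simp: normal_density_nonneg)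

lemma nn_integral_normal_density_square:
  assumes "0 < \<sigma>"
  shows "(\<integral>\<^sup>+ x. ennreal ((x - \<mu>)\<^sup>2 * normal_density \<mu> \<sigma> x) \<partial>lborel) = ennreal (\<sigma>\<^sup>2)"
  using normal_moment_even[OF assms, of \<mu> 1]
  by (subst nn_integral_eq_integral)
    (auto simp: has_bochner_integral_iff normal_density_nonneg mult.commute)

lemma nn_integral_mvn_dens:
  fixes \<theta> :: "real^'p"
  assumes "0 < \<sigma>"
  shows "(\<integral>\<^sup>+ x. ennreal (mvn_dens \<theta> \<sigma> x) \<partial>lborel) = 1"
  unfolding mvn_dens_eq_prod[OF assms]
  using assms
  by (subst prod_ennreal[symmetric], simp add: normal_density_nonneg, subst nn_integral_lborel_prod)
    (auto simp: nn_integral_normal_density)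

lemma nn_integral_mvn_dens_square:
  fixes \<theta> :: "real^'p"
  assumes "0 < \<sigma>"
  shows "(\<integral>\<^sup>+ x. ennreal ((norm (x - \<theta>))\<^sup>2 * mvn_dens \<theta> \<sigma> x) \<partial>lborel) = ennreal (real CARD('p) * \<sigma>\<^sup>2)"
proof -
  \<comment> \<open>In the \<open>i\<close>-th summand of the squared norm only the factor with
    \<open>b = i\<close> carries a square; the other factors integrate to 1.\<close>
  let ?f = "\<lambda>i b u. ennreal ((if b = i then (u - \<theta> \<bullet> b)\<^sup>2 else 1) * normal_density (\<theta> \<bullet> b) \<sigma> u)"
  have "ennreal ((norm (x - \<theta>))\<^sup>2 * mvn_dens \<theta> \<sigma> x) = (\<Sum>i\<in>Basis. \<Prod>b\<in>Basis. ?f i b (x \<bullet> b))" for x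
    unfolding norm_diff_square_eq_sum
    by (subst prod_ennreal, simp add: normal_density_nonneg, subst sum_ennreal)
      (auto simp: prod_nonneg normal_density_nonneg prod.distrib mvn_dens_eq_prod[OF assms] sum_distrib_right)
  then have "(\<integral>\<^sup>+ x. ennreal ((norm (x - \<theta>))\<^sup>2 * mvn_dens \<theta> \<sigma> x) \<partial>lborel)
     = (\<Sum>i\<in>(Basis::(real^'p) set). \<integral>\<^sup>+ x. (\<Prod>b\<in>Basis. ?f i b (x \<bullet> b)) \<partial>lborel)"
    by (simp add: nn_integral_sum)
  also have "\<dots> = (\<Sum>i\<in>(Basis::(real^'p) set). \<Prod>b\<in>Basis. \<integral>\<^sup>+ u. ?f i b u \<partial>lborel)"
    by (intro sum.cong nn_integral_lborel_prod) auto
  also have "\<dots> = (\<Sum>i\<in>(Basis::(real^'p) set). \<Prod>b\<in>(Basis::(real^'p) set). if b = i then ennreal (\<sigma>\<^sup>2) else 1)"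
    using assms by (intro sum.cong prod.cong refl)
      (auto simp: nn_integral_normal_density nn_integral_normal_density_square)
  also have "\<dots> = ennreal (real CARD('p) * \<sigma>\<^sup>2)"
    by (simp add: ennreal_mult ennreal_of_nat_eq_real_of_nat)
  finally show ?thesis .
qed

section \<open>Integration under the sample law\<close>

text \<open>\<open>S\<close> is written as \<open>\<sigma>\<^sup>2 * t\<close> with \<open>t\<close>
  chi-square distributed, so that the density of \<open>t\<close> is free of
  \<open>\<sigma>\<close>.\<close>

lemma nn_integral_sample_law:
  fixes \<theta> :: "real^'p"
  assumes n: "1 \<le> n" and F [measurable]: "F \<in> borel_measurable (borel \<Otimes>\<^sub>M borel)"
  shows "(\<integral>\<^sup>+ z. F z \<partial>sample_law n \<theta> \<sigma>)
     = (\<integral>\<^sup>+ x. \<integral>\<^sup>+ t. F (x, \<sigma>\<^sup>2 * t) * ennreal (mvn_dens \<theta> \<sigma> x * chi_dens n t) \<partial>lborel \<partial>lborel)"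
proof -
  let ?D = "distr (chi_square n) borel (\<lambda>s. \<sigma>\<^sup>2 * s)"
  have [measurable_cong]: "sets (chi_square n) = sets borel" "sets (mvnormal \<theta> \<sigma>) = sets borel"
    by (simp_all add: chi_square_def mvnormal_def)
  interpret D: prob_space ?D
    by (intro prob_space.prob_space_distr prob_space_chi_square n) measurable
  have "F \<in> borel_measurable (mvnormal \<theta> \<sigma> \<Otimes>\<^sub>M ?D)"
    by measurable
  then have "(\<integral>\<^sup>+ z. F z \<partial>sample_law n \<theta> \<sigma>) = (\<integral>\<^sup>+ x. \<integral>\<^sup>+ s. F (x, s) \<partial>?D \<partial>mvnormal \<theta> \<sigma>)"
    by (simp add: sample_law_def D.nn_integral_fst[symmetric])
  also have "\<dots> = (\<integral>\<^sup>+ x. \<integral>\<^sup>+ t. F (x, \<sigma>\<^sup>2 * t) * ennreal (chi_dens n t) \<partial>lborel \<partial>mvnormal \<theta> \<sigma>)"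
    by (intro nn_integral_cong)
      (simp add: nn_integral_distr, simp add: chi_square_eq_density nn_integral_density mult.commute)
  also have "\<dots> = (\<integral>\<^sup>+ x. ennreal (mvn_dens \<theta> \<sigma> x) * (\<integral>\<^sup>+ t. F (x, \<sigma>\<^sup>2 * t) * ennreal (chi_dens n t) \<partial>lborel) \<partial>lborel)"
    unfolding mvnormal_eq_density by (subst nn_integral_density) auto
  also have "\<dots> = (\<integral>\<^sup>+ x. \<integral>\<^sup>+ t. F (x, \<sigma>\<^sup>2 * t) * ennreal (mvn_dens \<theta> \<sigma> x * chi_dens n t) \<partial>lborel \<partial>lborel)"
    by (intro nn_integral_cong, subst nn_integral_cmult[symmetric])
      (auto simp: ennreal_mult mvn_dens_nonneg chi_dens_nonneg[OF n] mult_ac intro!: nn_integral_cong)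
  finally show ?thesis .
qed

text \<open>With this explicit value, strict improvement on \<open>X\<close> at some parameter
  forces a positive risk reduction there.\<close>

lemma mse_fst:
  fixes \<theta> :: "real^'p"
  assumes n: "1 \<le> n" and \<sigma>: "0 < \<sigma>"
  shows "mse n fst \<theta> \<sigma> = ennreal (real CARD('p) * \<sigma>\<^sup>2)"
proof -
  have "mse n fst \<theta> \<sigma> = (\<integral>\<^sup>+ x. \<integral>\<^sup>+ t. ennreal ((norm (x - \<theta>))\<^sup>2) * ennreal (mvn_dens \<theta> \<sigma> x * chi_dens n t) \<partial>lborel \<partial>lborel)"
    unfolding mse_def by (subst nn_integral_sample_law[OF n]) auto
  also have "\<dots> = (\<integral>\<^sup>+ x. ennreal ((norm (x - \<theta>))\<^sup>2 * mvn_dens \<theta> \<sigma> x) * (\<integral>\<^sup>+ t. ennreal (chi_dens n t) \<partial>lborel) \<partial>lborel)"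
    by (intro nn_integral_cong, subst nn_integral_cmult[symmetric])
      (auto simp: ennreal_mult mvn_dens_nonneg chi_dens_nonneg[OF n] mult_ac intro!: nn_integral_cong)
  also have "(\<integral>\<^sup>+ t. ennreal (chi_dens n t) \<partial>lborel) = 1"
    using nn_integral_chi_dens_power[OF n, of 0] Gamma_real_pos[of "real n / 2"] n by (cases "Gamma (real n / 2) = 0") simp_all
  finally show ?thesis
    by (simp add: nn_integral_mvn_dens_square[OF \<sigma>])
qed

text \<open>The truncated estimator is at most a constant times \<open>S\<close>, so this bound
  makes its risk finite.\<close>

lemma nn_integral_sample_law_snd_square_finite:
  fixes \<theta> :: "real^'p"
  assumes n: "1 \<le> n" and \<sigma>: "0 < \<sigma>" and "0 \<le> c" "0 \<le> d"
  shows "(\<integral>\<^sup>+ z. ennreal (c * (snd z)\<^sup>2 + d) \<partial>sample_law n \<theta> \<sigma>) < \<infinity>"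
proof -
  have "(\<integral>\<^sup>+ z. ennreal (c * (snd z)\<^sup>2 + d) \<partial>sample_law n \<theta> \<sigma>)
     = (\<integral>\<^sup>+ x. \<integral>\<^sup>+ t. ennreal (c * (\<sigma>\<^sup>2 * t)\<^sup>2 + d) * ennreal (mvn_dens \<theta> \<sigma> x * chi_dens n t) \<partial>lborel \<partial>lborel)"
    by (subst nn_integral_sample_law[OF n]) auto
  \<comment> \<open>The factor \<open>t ^ 0\<close> is kept so that the moment formula applies to
    both summands.\<close>
  also have "\<dots> = (\<integral>\<^sup>+ x. ennreal (mvn_dens \<theta> \<sigma> x) * (\<integral>\<^sup>+ t. ennreal (c * \<sigma> ^ 4) * ennreal (t ^ 2 * chi_dens n t) + ennreal d * ennreal (t ^ 0 * chi_dens n t) \<partial>lborel) \<partial>lborel)"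
    using assms
    by (intro nn_integral_cong, subst nn_integral_cmult[symmetric])
      (auto intro!: nn_integral_cong simp: ennreal_mult[symmetric] ennreal_plus[symmetric] mvn_dens_nonneg chi_dens_nonneg power_mult_distrib algebra_simps
        simp del: ennreal_plus)
  also have "\<dots> = (\<integral>\<^sup>+ t. ennreal (c * \<sigma> ^ 4) * ennreal (t ^ 2 * chi_dens n t) + ennreal d * ennreal (t ^ 0 * chi_dens n t) \<partial>lborel)"
    by (subst nn_integral_multc) (auto simp: nn_integral_mvn_dens[OF \<sigma>])
  also have "\<dots> < \<infinity>"
    by (subst nn_integral_add, simp, simp, subst (1 2) nn_integral_cmult)
      (simp_all del: power_0 add: nn_integral_chi_dens_power[OF n] ennreal_mult_less_top)
  finally show ?thesis .
qed

section \<open>Change of variables and symmetrization\<close>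

text \<open>Used with \<open>c = -1\<close> for reflection invariance and with
  \<open>c = \<sigma> * sqrt t\<close> for the substitution
  \<open>x = c *\<^sub>R y\<close>.\<close>

lemma nn_integral_lborel_scaleR:
  fixes f :: "'a::euclidean_space \<Rightarrow> ennreal"
  assumes [measurable]: "f \<in> borel_measurable borel" and c: "c \<noteq> 0"
  shows "(\<integral>\<^sup>+ x. f x \<partial>lborel) = ennreal (\<bar>c\<bar> ^ DIM('a)) * (\<integral>\<^sup>+ x. f (c *\<^sub>R x) \<partial>lborel)"
  by (subst lborel_affine[OF c, of 0]) (simp add: nn_integral_density nn_integral_distr nn_integral_cmult)

text \<open>Lebesgue measure is invariant under reflection. Averaging over both signs later turns
  the exponential of a linear term into \<open>cosh\<close>.\<close>

lemma nn_integral_lborel_symmetrize: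
  fixes f :: "'a::euclidean_space \<Rightarrow> real"
  assumes [measurable]: "f \<in> borel_measurable borel" and nonneg: "\<And>x. 0 \<le> f x"
  shows "(\<integral>\<^sup>+ x. ennreal (f x) \<partial>lborel) = (\<integral>\<^sup>+ x. ennreal ((f x + f (- x)) / 2) \<partial>lborel)"
proof -
  let ?I = "\<integral>\<^sup>+ x. ennreal (f x) \<partial>lborel"
  have minus: "(\<integral>\<^sup>+ x. ennreal (f (- x)) \<partial>lborel) = ?I"
    using nn_integral_lborel_scaleR[of "\<lambda>x. ennreal (f x)" "-1"] by simp
  have "(\<integral>\<^sup>+ x. ennreal ((f x + f (- x)) / 2) \<partial>lborel)
      = (\<integral>\<^sup>+ x. ennreal (1/2) * ennreal (f x) + ennreal (1/2) * ennreal (f (- x)) \<partial>lborel)"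
  proof (intro nn_integral_cong)
    fix x
    have "(f x + f (- x)) / 2 = 1/2 * f x + 1/2 * f (- x)"
      by simp
    then show "ennreal ((f x + f (- x)) / 2) = ennreal (1/2) * ennreal (f x) + ennreal (1/2) * ennreal (f (- x))"
      using nonneg[of x] nonneg[of "- x"]
      by (simp only: ennreal_plus ennreal_mult mult_nonneg_nonneg zero_le_divide_1_iff zero_le_numeral)
  qed
  also have "\<dots> = ennreal (1/2) * ?I + ennreal (1/2) * ?I"
    by (subst nn_integral_add, simp, simp, subst (1 2) nn_integral_cmult) (simp_all add: minus)
  also have "\<dots> = ?I"
    by (subst distrib_right[symmetric], subst ennreal_plus[symmetric]) simp_all
  finally show ?thesis by simp
qed

text \<open>The factors independent of \<open>y\<close> and \<open>t\<close>: the exponential of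
  \<open>- \<lambda> / 2\<close> and the normalizing constants for variance 1. The powers of
  \<open>\<sigma>\<close> cancel against the Jacobian.\<close>

definition kernel_const :: "nat \<Rightarrow> real^'p \<Rightarrow> real \<Rightarrow> real" where
  "kernel_const n \<theta> \<sigma> = exp (- (norm \<theta>)\<^sup>2 / (2 * \<sigma>\<^sup>2))
     / (sqrt (2 * pi) ^ CARD('p) * (2 powr (real n / 2) * Gamma (real n / 2)))"

text \<open>The density of \<open>(y, t)\<close>, averaged over \<open>\<plusminus>y\<close>, where \<open>x = \<sigma> \<surd>t y\<close> and \<open>s = \<sigma>\<^sup>2 t\<close>.\<close>

definition cosh_kernel :: "nat \<Rightarrow> real^'p \<Rightarrow> real \<Rightarrow> real^'p \<Rightarrow> real \<Rightarrow> real" where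
  "cosh_kernel n \<theta> \<sigma> y t =
     (if 0 < t then kernel_const n \<theta> \<sigma> * (t powr (real (n + CARD('p)) / 2 - 1)
        * exp (- ((1 + (norm y)\<^sup>2) / 2) * t)) * cosh (sqrt t * (y \<bullet> \<theta> / \<sigma>)) else 0)"

lemma kernel_const_pos: "1 \<le> n \<Longrightarrow> 0 < kernel_const n \<theta> \<sigma>"
  by (simp add: kernel_const_def Gamma_real_pos)

lemma cosh_kernel_nonneg: "1 \<le> n \<Longrightarrow> 0 \<le> cosh_kernel n \<theta> \<sigma> y t"
  using kernel_const_pos[of n \<theta> \<sigma>] by (simp add: cosh_kernel_def cosh_real_nonneg)

lemma cosh_kernel_pos: "1 \<le> n \<Longrightarrow> 0 < t \<Longrightarrow> 0 < cosh_kernel n \<theta> \<sigma> y t"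
  using kernel_const_pos[of n \<theta> \<sigma>] by (simp add: cosh_kernel_def cosh_real_pos)

lemma cosh_kernel_measurable [measurable]:
  "(\<lambda>z. cosh_kernel n \<theta> \<sigma> (fst z) (snd z)) \<in> borel_measurable (borel \<Otimes>\<^sub>M borel)"
  unfolding cosh_kernel_def cosh_def by measurable

text \<open>After expanding the square, only the cross term
  \<open>sqrt t * (y \<bullet> \<theta> / \<sigma>)\<close> is odd in \<open>y\<close>, and its two
  signs average to \<open>cosh\<close>. The Jacobian cancels \<open>\<sigma>\<close> in the
  normalizing constant and leaves the factor \<open>sqrt t ^ CARD('p)\<close>, which joins the
  chi-square power of \<open>t\<close>.\<close>

lemma symmetrized_density_eq_kernel:
  fixes \<theta> :: "real^'p"
  assumes \<sigma>: "0 < \<sigma>" and t: "0 < t"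
  defines "c \<equiv> \<sigma> * sqrt t"
  shows "\<bar>c\<bar> ^ CARD('p) * ((mvn_dens \<theta> \<sigma> (c *\<^sub>R y) + mvn_dens \<theta> \<sigma> (c *\<^sub>R (- y))) / 2 * chi_dens n t)
    = cosh_kernel n \<theta> \<sigma> y t"
proof -
  have c: "0 < c" "c\<^sup>2 = \<sigma>\<^sup>2 * t"
    using \<sigma> t by (simp_all add: c_def power_mult_distrib)
  have expand: "exp (- (norm (c *\<^sub>R x - \<theta>))\<^sup>2 / (2 * \<sigma>\<^sup>2))
     = exp (- (norm \<theta>)\<^sup>2 / (2 * \<sigma>\<^sup>2)) * exp (- ((norm x)\<^sup>2 / 2) * t) * exp (sqrt t * (x \<bullet> \<theta> / \<sigma>))" for x
  proof -
    have "(norm (c *\<^sub>R x - \<theta>))\<^sup>2 = c\<^sup>2 * (norm x)\<^sup>2 - 2 * c * (x \<bullet> \<theta>) + (norm \<theta>)\<^sup>2"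
      unfolding power2_norm_eq_inner by (simp add: algebra_simps inner_commute power2_eq_square)
    then have "- (norm (c *\<^sub>R x - \<theta>))\<^sup>2 / (2 * \<sigma>\<^sup>2)
       = - (norm \<theta>)\<^sup>2 / (2 * \<sigma>\<^sup>2) + (- ((norm x)\<^sup>2 / 2) * t) + sqrt t * (x \<bullet> \<theta> / \<sigma>)"
      unfolding c(2) using \<sigma> by (simp add: c_def field_simps power2_eq_square)
    then show ?thesis
      by (simp only: exp_add)
  qed
  have "sqrt t ^ CARD('p) = t powr (real CARD('p) / 2)"
    using t by (simp add: powr_half_sqrt[symmetric] powr_powr powr_realpow[symmetric])
  then have "sqrt t ^ CARD('p) * t powr (real n / 2 - 1) = t powr (real CARD('p) / 2 + (real n / 2 - 1))"
    by (simp only: powr_add)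
  also have "\<dots> = t powr (real (n + CARD('p)) / 2 - 1)"
    by (rule arg_cong[where f="\<lambda>u. t powr u"]) (simp add: add_divide_distrib)
  finally have pow: "t powr (real (n + CARD('p)) / 2 - 1) = sqrt t ^ CARD('p) * t powr (real n / 2 - 1)"
    by simp
  have scale: "\<bar>c\<bar> ^ CARD('p) / sqrt (2 * pi * \<sigma>\<^sup>2) ^ CARD('p) = sqrt t ^ CARD('p) / sqrt (2 * pi) ^ CARD('p)"
    using \<sigma> c by (simp add: real_sqrt_mult power_mult_distrib c_def)
  have ex: "exp (- ((1 + (norm y)\<^sup>2) / 2) * t) = exp (- ((norm y)\<^sup>2 / 2) * t) * exp (- t / 2)"
    by (simp add: exp_add[symmetric] algebra_simps add_divide_distrib)
  have "\<bar>c\<bar> ^ CARD('p) * ((mvn_dens \<theta> \<sigma> (c *\<^sub>R y) + mvn_dens \<theta> \<sigma> (c *\<^sub>R (- y))) / 2 * chi_dens n t)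
    = \<bar>c\<bar> ^ CARD('p) / sqrt (2 * pi * \<sigma>\<^sup>2) ^ CARD('p)
      * (exp (- (norm \<theta>)\<^sup>2 / (2 * \<sigma>\<^sup>2)) * exp (- ((norm y)\<^sup>2 / 2) * t) * cosh (sqrt t * (y \<bullet> \<theta> / \<sigma>)))
      * chi_dens n t"
    unfolding mvn_dens_def expand cosh_def by (simp add: algebra_simps add_divide_distrib)
  also have "\<dots> = cosh_kernel n \<theta> \<sigma> y t"
    unfolding scale cosh_kernel_def pow ex using t by (simp add: chi_dens_def kernel_const_def)
  finally show ?thesis .
qed

text \<open>In the new variables \<open>W_stat\<close> becomes \<open>(norm y)\<^sup>2\<close>, free
  of \<open>t\<close>. An estimator is then linear in \<open>t\<close> at fixed \<open>y\<close>,
  and risks can be compared one \<open>y\<close> at a time.\<close>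

lemma nn_integral_sample_law_kernel:
  fixes \<theta> :: "real^'p" and G :: "real \<Rightarrow> real \<Rightarrow> real"
  assumes n: "1 \<le> n" and \<sigma>: "0 < \<sigma>"
    and G [measurable]: "(\<lambda>z. G (fst z) (snd z)) \<in> borel_measurable (borel \<Otimes>\<^sub>M borel)"
    and G_nonneg: "\<And>v s. 0 \<le> G v s"
  shows "(\<integral>\<^sup>+ z. ennreal (G (W_stat z) (snd z)) \<partial>sample_law n \<theta> \<sigma>)
     = (\<integral>\<^sup>+ y. \<integral>\<^sup>+ t. ennreal (G ((norm y)\<^sup>2) (\<sigma>\<^sup>2 * t) * cosh_kernel n \<theta> \<sigma> y t) \<partial>lborel \<partial>lborel)"
proof -
  let ?H = "\<lambda>t x. G ((norm x)\<^sup>2 / (\<sigma>\<^sup>2 * t)) (\<sigma>\<^sup>2 * t) * (mvn_dens \<theta> \<sigma> x * chi_dens n t)"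
  have [measurable]: "(\<lambda>x. G (f x) (g x)) \<in> borel_measurable M"
    if "f \<in> borel_measurable M" "g \<in> borel_measurable M" for f g and M :: "'z measure"
    using measurable_compose[OF measurable_Pair[OF that] G] by simp
  have [measurable]: "(\<lambda>x. cosh_kernel n \<theta> \<sigma> (f x) (g x)) \<in> borel_measurable M"
    if "f \<in> borel_measurable M" "g \<in> borel_measurable M" for f g and M :: "'z measure"
    using measurable_compose[OF measurable_Pair[OF that] cosh_kernel_measurable] by simp
  have "(\<integral>\<^sup>+ z. ennreal (G (W_stat z) (snd z)) \<partial>sample_law n \<theta> \<sigma>)
     = (\<integral>\<^sup>+ x. \<integral>\<^sup>+ t. ennreal (?H t x) \<partial>lborel \<partial>lborel)"
    unfolding W_stat_def
    by (subst nn_integral_sample_law[OF n]) (simp_all add: ennreal_mult G_nonneg mvn_dens_nonneg chi_dens_nonneg[OF n])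
  \<comment> \<open>The substitution in \<open>x\<close> depends on \<open>t\<close>, so it is made
    with \<open>t\<close> outside; a second exchange puts \<open>t\<close> back inside.\<close>
  also have "\<dots> = (\<integral>\<^sup>+ t. \<integral>\<^sup>+ x. ennreal (?H t x) \<partial>lborel \<partial>lborel)"
    by (rule lborel_pair.Fubini') measurable
  also have "\<dots> = (\<integral>\<^sup>+ t. \<integral>\<^sup>+ y. ennreal (G ((norm y)\<^sup>2) (\<sigma>\<^sup>2 * t) * cosh_kernel n \<theta> \<sigma> y t) \<partial>lborel \<partial>lborel)"
  proof (rule nn_integral_cong)
    fix t :: real
    show "(\<integral>\<^sup>+ x. ennreal (?H t x) \<partial>lborel)
       = (\<integral>\<^sup>+ y. ennreal (G ((norm y)\<^sup>2) (\<sigma>\<^sup>2 * t) * cosh_kernel n \<theta> \<sigma> y t) \<partial>lborel)"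
    proof (cases "0 < t")
      case True
      define c where "c = \<sigma> * sqrt t"
      have c: "0 < c" "c\<^sup>2 = \<sigma>\<^sup>2 * t"
        using \<sigma> True by (simp_all add: c_def power_mult_distrib)
      have W: "(norm (c *\<^sub>R x))\<^sup>2 / (\<sigma>\<^sup>2 * t) = (norm x)\<^sup>2" for x :: "real^'p"
        using c \<sigma> True by (simp add: power_mult_distrib)
      have H_nonneg: "0 \<le> ?H t x" for x
        by (simp add: G_nonneg mvn_dens_nonneg chi_dens_nonneg[OF n])
      have "(\<integral>\<^sup>+ x. ennreal (?H t x) \<partial>lborel)
         = ennreal (\<bar>c\<bar> ^ CARD('p)) * (\<integral>\<^sup>+ x. ennreal (?H t (c *\<^sub>R x)) \<partial>lborel)"
        using nn_integral_lborel_scaleR[of "\<lambda>x. ennreal (?H t x)" c] c by simp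
      \<comment> \<open>The factor \<open>G\<close> depends on \<open>x\<close> only through its
        norm, so averaging over signs affects only the normal density.\<close>
      also have "(\<integral>\<^sup>+ x. ennreal (?H t (c *\<^sub>R x)) \<partial>lborel)
         = (\<integral>\<^sup>+ x. ennreal ((?H t (c *\<^sub>R x) + ?H t (c *\<^sub>R (- x))) / 2) \<partial>lborel)"
        by (intro nn_integral_lborel_symmetrize H_nonneg) measurable
      also have "ennreal (\<bar>c\<bar> ^ CARD('p)) * \<dots>
         = (\<integral>\<^sup>+ x. ennreal (\<bar>c\<bar> ^ CARD('p) * ((?H t (c *\<^sub>R x) + ?H t (c *\<^sub>R (- x))) / 2)) \<partial>lborel)"
        by (subst nn_integral_cmult[symmetric]) (auto simp: ennreal_mult'[symmetric])
      also have "\<dots> = (\<integral>\<^sup>+ y. ennreal (G ((norm y)\<^sup>2) (\<sigma>\<^sup>2 * t) * cosh_kernel n \<theta> \<sigma> y t) \<partial>lborel)"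
        unfolding W norm_minus_cancel
        by (intro nn_integral_cong arg_cong[where f=ennreal],
            subst symmetrized_density_eq_kernel[OF \<sigma> True, symmetric])
          (simp add: c_def[symmetric] algebra_simps add_divide_distrib)
      finally show ?thesis .
    qed (simp add: chi_dens_def cosh_kernel_def)
  qed
  also have "\<dots> = (\<integral>\<^sup>+ y. \<integral>\<^sup>+ t. ennreal (G ((norm y)\<^sup>2) (\<sigma>\<^sup>2 * t) * cosh_kernel n \<theta> \<sigma> y t) \<partial>lborel \<partial>lborel)"
    by (rule lborel_pair.Fubini') measurable
  finally show ?thesis .
qed

section \<open>The inequality at a fixed point \<open>y\<close>\<close>

text \<open>Put \<open>A = \<sigma>\<^sup>2 * t * c0 - R\<close> and
  \<open>B = \<sigma>\<^sup>2 * t * (b - c0)\<close>. Since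
  \<open>(A + B)\<^sup>2 = A\<^sup>2 + B\<^sup>2 + 2 * A * B\<close>, the claim expresses that
  \<open>A * B\<close> has a nonnegative integral against the kernel.\<close>

lemma cosh_kernel_inequality:
  fixes \<theta> :: "real^'p"
  assumes n: "1 \<le> n" and \<sigma>: "0 < \<sigma>" and c0: "0 < c0" and b: "c0 < b"
    and v: "(norm y)\<^sup>2 \<le> w0"
    and R: "R \<le> c0 * \<sigma>\<^sup>2 * (real (n + CARD('p) + 2) / (1 + w0))"
  shows "(\<integral>\<^sup>+ t. ennreal (((\<sigma>\<^sup>2 * t * c0 - R)\<^sup>2 + (\<sigma>\<^sup>2 * t * (b - c0))\<^sup>2) * cosh_kernel n \<theta> \<sigma> y t) \<partial>lborel)
    \<le> (\<integral>\<^sup>+ t. ennreal ((\<sigma>\<^sup>2 * t * b - R)\<^sup>2 * cosh_kernel n \<theta> \<sigma> y t) \<partial>lborel)"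
    (is "?L \<le> ?U")
proof -
  define q where "q = real (n + CARD('p)) / 2"
  define \<beta> where "\<beta> = (1 + (norm y)\<^sup>2) / 2"
  define t1 where "t1 = real (n + CARD('p) + 2) / (1 + w0)"
  define C where "C t = cosh (sqrt t * (y \<bullet> \<theta> / \<sigma>))" for t
  \<comment> \<open>The constant left in the lower bound of the cross term once \<open>cosh\<close>
    is frozen at \<open>t1\<close>.\<close>
  define D where "D = 2 * (b - c0) * c0 * \<sigma> ^ 4 * kernel_const n \<theta> \<sigma> * C t1"
  \<comment> \<open>A gamma integrand of shape \<open>q + k\<close>; \<open>m 0\<close> is the
    kernel without its constant and without \<open>cosh\<close>.\<close>
  define m where "m k t = (if 0 < t then t powr (q + k - 1) * exp (- \<beta> * t) else 0)" for k t :: real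
  have w0: "0 \<le> w0"
    using v by (meson order_trans zero_le_power2)
  have q: "0 < q" and \<beta>: "0 < \<beta>" and t1: "0 \<le> t1"
    using n w0 by (simp_all add: q_def \<beta>_def t1_def add_pos_nonneg)
  have C_pos: "0 < C t" for t
    by (simp add: C_def cosh_real_pos)
  have D: "0 \<le> D"
    using b c0 C_pos[of t1] kernel_const_pos[OF n, of \<theta> \<sigma>] by (simp add: D_def less_imp_le)
  have C_mono: "C s \<le> C t" if "0 \<le> s" "s \<le> t" for s t
  proof -
    have "cosh \<bar>sqrt s * (y \<bullet> \<theta> / \<sigma>)\<bar> \<le> cosh \<bar>sqrt t * (y \<bullet> \<theta> / \<sigma>)\<bar>"
      using that by (subst cosh_real_nonneg_le_iff) (auto simp: abs_mult intro!: mult_right_mono divide_right_mono)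
    then show ?thesis
      by (simp only: cosh_real_abs C_def)
  qed
  have m_nonneg: "0 \<le> m k t" for k t
    by (simp add: m_def)
  have m_shift: "m 1 t = t * m 0 t" "m 2 t = t\<^sup>2 * m 0 t" for t
  proof -
    have "t powr (q + k - 1) = t powr k * t powr (q - 1)" for k
      by (subst powr_add[symmetric]) (simp add: algebra_simps)
    from this[of 1] this[of 2] show "m 1 t = t * m 0 t" "m 2 t = t\<^sup>2 * m 0 t"
      by (simp_all add: m_def)
  qed
  have m_measurable [measurable]: "m k \<in> borel_measurable borel" for k
    unfolding m_def by measurable
  have [measurable]: "(\<lambda>t. cosh_kernel n \<theta> \<sigma> y t) \<in> borel_measurable borel"
    unfolding cosh_kernel_def cosh_def by measurable
  have m_int: "(\<integral>\<^sup>+ t. ennreal (m k t) \<partial>lborel) = ennreal (Gamma (q + k) / \<beta> powr (q + k))" if "0 \<le> k" for k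
    unfolding m_def using nn_integral_gamma_density[of "q + k" \<beta>] q \<beta> that by simp
  have add_m: "(\<integral>\<^sup>+ t. ennreal (f t + d * m k t) \<partial>lborel)
     = (\<integral>\<^sup>+ t. ennreal (f t) \<partial>lborel) + ennreal (d * (Gamma (q + k) / \<beta> powr (q + k)))"
    if [measurable]: "f \<in> borel_measurable borel" and "\<And>t. 0 \<le> f t" "0 \<le> d" "0 \<le> k" for f d k
  proof -
    have "(\<integral>\<^sup>+ t. ennreal (f t + d * m k t) \<partial>lborel)
       = (\<integral>\<^sup>+ t. ennreal (f t) + ennreal d * ennreal (m k t) \<partial>lborel)"
      using that m_nonneg by (intro nn_integral_cong) (simp add: ennreal_mult)
    also have "\<dots> = (\<integral>\<^sup>+ t. ennreal (f t) \<partial>lborel) + ennreal d * (\<integral>\<^sup>+ t. ennreal (m k t) \<partial>lborel)"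
      by (subst nn_integral_add, simp, simp, subst nn_integral_cmult) simp_all
    also have "\<dots> = (\<integral>\<^sup>+ t. ennreal (f t) \<partial>lborel) + ennreal (d * (Gamma (q + k) / \<beta> powr (q + k)))"
      by (simp only: m_int[OF \<open>0 \<le> k\<close>] ennreal_mult'[OF \<open>0 \<le> d\<close>])
    finally show ?thesis .
  qed
  \<comment> \<open>As \<open>Gamma (q + 2) = (q + 1) * Gamma (q + 1)\<close>, this says
    \<open>\<beta> * t1 \<le> q + 1\<close>. Because \<open>2 * (q + 1)\<close> equals the numerator
    of \<open>t1\<close>, that amounts to \<open>(norm y)\<^sup>2 \<le> w0\<close>.\<close>
  have moments: "t1 * (Gamma (q + 1) / \<beta> powr (q + 1)) \<le> Gamma (q + 2) / \<beta> powr (q + 2)"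
  proof -
    have "\<beta> * t1 = (1 + (norm y)\<^sup>2) / (1 + w0) * (q + 1)"
      using w0 by (simp add: \<beta>_def t1_def q_def field_simps)
    also have "\<dots> \<le> 1 * (q + 1)"
      using v w0 q by (intro mult_right_mono) simp_all
    finally have "\<beta> * t1 \<le> q + 1"
      by simp
    moreover have "Gamma (q + 2) = (q + 1) * Gamma (q + 1)"
      using Gamma_plus1[of "q + 1"] q by (auto simp: add.commute nonpos_Ints_def)
    moreover have "\<beta> powr (q + 2) = \<beta> * \<beta> powr (q + 1)"
      using \<beta> powr_add[of \<beta> 1 "q + 1"] by (simp add: add.commute)
    moreover have "0 < Gamma (q + 1)"
      using q by (intro Gamma_real_pos) simp
    ultimately show ?thesis
      using \<beta> mult_right_mono[of "\<beta> * t1" "q + 1" "Gamma (q + 1)"] by (simp add: field_simps)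
  qed
  \<comment> \<open>Sums instead of differences, because \<open>?U\<close> and \<open>?L\<close> live in \<open>ennreal\<close>.\<close>
  have pointwise: "((\<sigma>\<^sup>2 * t * c0 - R)\<^sup>2 + (\<sigma>\<^sup>2 * t * (b - c0))\<^sup>2) * cosh_kernel n \<theta> \<sigma> y t + D * m 2 t
     \<le> (\<sigma>\<^sup>2 * t * b - R)\<^sup>2 * cosh_kernel n \<theta> \<sigma> y t + D * t1 * m 1 t" for t
  proof (cases "0 < t")
    case True
    have cosh_kernel: "cosh_kernel n \<theta> \<sigma> y t = kernel_const n \<theta> \<sigma> * m 0 t * C t"
      using True by (simp add: cosh_kernel_def m_def C_def q_def \<beta>_def)
    let ?P = "2 * (b - c0) * \<sigma>\<^sup>2 * t"
    have P: "0 \<le> ?P"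
      using b True by simp
    \<comment> \<open>By monotonicity of \<open>C\<close>, the product of \<open>t - t1\<close> and
      \<open>C t - C t1\<close> is nonnegative on either side of \<open>t1\<close>.\<close>
    have "(t - t1) * C t1 \<le> (t - t1) * C t"
    proof (cases "t1 \<le> t")
      case True
      then show ?thesis using C_mono[of t1 t] t1 by (intro mult_left_mono) auto
    next
      case False
      then show ?thesis using C_mono[of t t1] \<open>0 < t\<close> by (intro mult_left_mono_neg) auto
    qed
    then have "?P * (c0 * \<sigma>\<^sup>2) * ((t - t1) * C t1) \<le> ?P * (c0 * \<sigma>\<^sup>2) * ((t - t1) * C t)"
      by (rule mult_left_mono) (intro mult_nonneg_nonneg[OF P], use c0 in simp)
    also have "\<dots> = ?P * (\<sigma>\<^sup>2 * t * c0 - c0 * \<sigma>\<^sup>2 * t1) * C t"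
      by (simp add: algebra_simps)
    also have "\<dots> \<le> ?P * (\<sigma>\<^sup>2 * t * c0 - R) * C t"
      by (intro mult_right_mono mult_left_mono P less_imp_le[OF C_pos] diff_left_mono R[folded t1_def])
    also have "\<dots> = ((\<sigma>\<^sup>2 * t * b - R)\<^sup>2 - ((\<sigma>\<^sup>2 * t * c0 - R)\<^sup>2 + (\<sigma>\<^sup>2 * t * (b - c0))\<^sup>2)) * C t"
      by (simp add: power2_eq_square algebra_simps)
    finally have "kernel_const n \<theta> \<sigma> * m 0 t * (?P * (c0 * \<sigma>\<^sup>2) * ((t - t1) * C t1))
      \<le> kernel_const n \<theta> \<sigma> * m 0 t * (((\<sigma>\<^sup>2 * t * b - R)\<^sup>2 - ((\<sigma>\<^sup>2 * t * c0 - R)\<^sup>2 + (\<sigma>\<^sup>2 * t * (b - c0))\<^sup>2)) * C t)"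
      using kernel_const_pos[OF n, of \<theta> \<sigma>] m_nonneg by (intro mult_left_mono) (simp_all add: less_imp_le)
    moreover have "kernel_const n \<theta> \<sigma> * m 0 t * (?P * (c0 * \<sigma>\<^sup>2) * ((t - t1) * C t1)) = D * m 2 t - D * t1 * m 1 t"
      unfolding m_shift D_def by (simp add: algebra_simps power2_eq_square power4_eq_xxxx)
    moreover have "kernel_const n \<theta> \<sigma> * m 0 t * (((\<sigma>\<^sup>2 * t * b - R)\<^sup>2 - ((\<sigma>\<^sup>2 * t * c0 - R)\<^sup>2 + (\<sigma>\<^sup>2 * t * (b - c0))\<^sup>2)) * C t)
      = (\<sigma>\<^sup>2 * t * b - R)\<^sup>2 * cosh_kernel n \<theta> \<sigma> y t
        - ((\<sigma>\<^sup>2 * t * c0 - R)\<^sup>2 + (\<sigma>\<^sup>2 * t * (b - c0))\<^sup>2) * cosh_kernel n \<theta> \<sigma> y t"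
      unfolding cosh_kernel by (simp only: left_diff_distrib right_diff_distrib mult_ac)
    ultimately show ?thesis
      by linarith
  qed (simp add: cosh_kernel_def m_def)
  let ?e2 = "D * (Gamma (q + 2) / \<beta> powr (q + 2))" and ?e1 = "D * t1 * (Gamma (q + 1) / \<beta> powr (q + 1))"
  have "?L + ennreal ?e2
     = (\<integral>\<^sup>+ t. ennreal (((\<sigma>\<^sup>2 * t * c0 - R)\<^sup>2 + (\<sigma>\<^sup>2 * t * (b - c0))\<^sup>2) * cosh_kernel n \<theta> \<sigma> y t + D * m 2 t) \<partial>lborel)"
    using D by (intro add_m[symmetric]) (simp_all add: cosh_kernel_nonneg[OF n])
  also have "\<dots> \<le> (\<integral>\<^sup>+ t. ennreal ((\<sigma>\<^sup>2 * t * b - R)\<^sup>2 * cosh_kernel n \<theta> \<sigma> y t + D * t1 * m 1 t) \<partial>lborel)"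
    by (intro nn_integral_mono ennreal_leI pointwise)
  also have "\<dots> = ?U + ennreal ?e1"
    using D t1 by (intro add_m) (simp_all add: cosh_kernel_nonneg[OF n])
  also have "\<dots> \<le> ?U + ennreal ?e2"
    using mult_left_mono[OF moments D] by (intro add_left_mono ennreal_leI) (simp only: mult.assoc)
  finally show ?thesis
    by (simp add: ennreal_add_left_cancel_le add.commute)
qed

section \<open>Truncation under the sample law\<close>

lemma sets_sample_law [measurable_cong]:
  fixes \<theta> :: "real^'p"
  shows "sets (sample_law n \<theta> \<sigma>) = sets (borel \<Otimes>\<^sub>M borel)"
  unfolding sample_law_def by (intro sets_pair_measure_cong) (simp_all add: mvnormal_def)

lemma W_stat_measurable [measurable]: "W_stat \<in> borel_measurable (borel \<Otimes>\<^sub>M borel)"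
  unfolding W_stat_def[abs_def] by measurable

lemma AE_sample_law_snd_pos:
  fixes \<theta> :: "real^'p"
  assumes n: "1 \<le> n" and \<sigma>: "0 < \<sigma>"
  shows "AE z in sample_law n \<theta> \<sigma>. 0 < snd z"
proof -
  let ?f = "\<lambda>z::(real^'p) \<times> real. if snd z \<le> 0 then 1 else (0::ennreal)"
  have "(\<integral>\<^sup>+ z. ?f z \<partial>sample_law n \<theta> \<sigma>) = 0"
    using \<sigma> by (subst nn_integral_sample_law[OF n])
      (auto simp: mult_le_0_iff chi_dens_def intro!: nn_integral_zero' AE_I2)
  then have "AE z in sample_law n \<theta> \<sigma>. ?f z = 0"
    by (subst (asm) nn_integral_0_iff_AE) auto
  then show ?thesis
    by eventually_elim (auto split: if_splits)
qed

text \<open>A nonempty open set has positive Lebesgue measure.\<close>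

lemma open_AE_lborel_notin:
  fixes U :: "'a::euclidean_space set"
  assumes "open U" "AE x in lborel. x \<notin> U"
  shows "U = {}"
proof -
  have "U \<in> null_sets lborel"
    using assms by (subst AE_iff_null_sets) auto
  then have "negligible U"
    by (simp add: negligible_iff_null_sets null_sets_completionI)
  then show ?thesis
    using open_not_negligible[OF \<open>open U\<close>] by auto
qed

text \<open>Where \<open>b \<le> c0\<close> the two integrands agree. Elsewhere \<open>b_le\<close>
  forces \<open>(norm y)\<^sup>2 \<le> w0\<close>, and the inequality at fixed \<open>y\<close>
  applies.\<close>

lemma truncation_inequality:
  fixes \<theta> :: "real^'p" and b :: "real \<Rightarrow> real"
  assumes n: "1 \<le> n" and \<sigma>: "0 < \<sigma>" and c0: "0 < c0"
    and b [measurable]: "b \<in> borel_measurable borel"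
    and b_le: "\<And>w. w0 < w \<Longrightarrow> b w \<le> c0"
    and R: "R \<le> c0 * \<sigma>\<^sup>2 * (real (n + CARD('p) + 2) / (1 + w0))"
  shows "(\<integral>\<^sup>+ z. ennreal ((snd z * min (b (W_stat z)) c0 - R)\<^sup>2
              + (snd z * (b (W_stat z) - min (b (W_stat z)) c0))\<^sup>2) \<partial>sample_law n \<theta> \<sigma>)
    \<le> (\<integral>\<^sup>+ z. ennreal ((snd z * b (W_stat z) - R)\<^sup>2) \<partial>sample_law n \<theta> \<sigma>)"
proof -
  let ?G1 = "\<lambda>v s. (s * min (b v) c0 - R)\<^sup>2 + (s * (b v - min (b v) c0))\<^sup>2"
  let ?G0 = "\<lambda>v s. (s * b v - R)\<^sup>2"
  have "(\<integral>\<^sup>+ z. ennreal (?G1 (W_stat z) (snd z)) \<partial>sample_law n \<theta> \<sigma>)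
     = (\<integral>\<^sup>+ y. \<integral>\<^sup>+ t. ennreal (?G1 ((norm y)\<^sup>2) (\<sigma>\<^sup>2 * t) * cosh_kernel n \<theta> \<sigma> y t) \<partial>lborel \<partial>lborel)"
    by (rule nn_integral_sample_law_kernel[OF n \<sigma>, of ?G1]) simp_all
  also have "\<dots> \<le> (\<integral>\<^sup>+ y. \<integral>\<^sup>+ t. ennreal (?G0 ((norm y)\<^sup>2) (\<sigma>\<^sup>2 * t) * cosh_kernel n \<theta> \<sigma> y t) \<partial>lborel \<partial>lborel)"
  proof (rule nn_integral_mono)
    fix y :: "real^'p"
    show "(\<integral>\<^sup>+ t. ennreal (?G1 ((norm y)\<^sup>2) (\<sigma>\<^sup>2 * t) * cosh_kernel n \<theta> \<sigma> y t) \<partial>lborel)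
       \<le> (\<integral>\<^sup>+ t. ennreal (?G0 ((norm y)\<^sup>2) (\<sigma>\<^sup>2 * t) * cosh_kernel n \<theta> \<sigma> y t) \<partial>lborel)"
    proof (cases "b ((norm y)\<^sup>2) \<le> c0")
      case False
      then have "(norm y)\<^sup>2 \<le> w0"
        using b_le by (meson not_le)
      from cosh_kernel_inequality[OF n \<sigma> c0 _ this R, of "b ((norm y)\<^sup>2)"] False show ?thesis
        by (simp add: min_def)
    qed (simp add: min_def)
  qed
  also have "\<dots> = (\<integral>\<^sup>+ z. ennreal (?G0 (W_stat z) (snd z)) \<partial>sample_law n \<theta> \<sigma>)"
    by (rule nn_integral_sample_law_kernel[OF n \<sigma>, of ?G0, symmetric]) simp_all
  finally show ?thesis .
qed

text \<open>If the gap vanished, the inner integral would be zero for almost every \<open>y\<close>.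
  On a nonempty open set of \<open>y\<close>, however, its integrand is positive for every
  \<open>t > 0\<close>.\<close>

lemma truncation_gap_pos:
  fixes \<theta> :: "real^'p" and b :: "real \<Rightarrow> real"
  assumes n: "1 \<le> n" and \<sigma>: "0 < \<sigma>"
    and b [measurable]: "b \<in> borel_measurable borel"
    and cont: "continuous_on {0<..} b"
    and w: "0 < w" "c0 < b w"
  shows "0 < (\<integral>\<^sup>+ z. ennreal ((snd z * (b (W_stat z) - min (b (W_stat z)) c0))\<^sup>2) \<partial>sample_law n \<theta> \<sigma>)"
proof (rule ccontr)
  let ?G = "\<lambda>v s. (s * (b v - min (b v) c0))\<^sup>2"
  let ?J = "\<lambda>y. \<integral>\<^sup>+ t. ennreal (?G ((norm y)\<^sup>2) (\<sigma>\<^sup>2 * t) * cosh_kernel n \<theta> \<sigma> y t) \<partial>lborel"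
  \<comment> \<open>The origin is excluded because \<open>b\<close> is continuous only on the
    positive half-line.\<close>
  define U where "U = {y::real^'p. y \<noteq> 0 \<and> c0 < b ((norm y)\<^sup>2)}"
  have [measurable]: "(\<lambda>x. cosh_kernel n \<theta> \<sigma> (f x) (g x)) \<in> borel_measurable M"
    if "f \<in> borel_measurable M" "g \<in> borel_measurable M" for f g and M :: "'z measure"
    using measurable_compose[OF measurable_Pair[OF that] cosh_kernel_measurable] by simp
  assume "\<not> 0 < (\<integral>\<^sup>+ z. ennreal (?G (W_stat z) (snd z)) \<partial>sample_law n \<theta> \<sigma>)"
  then have "(\<integral>\<^sup>+ y. ?J y \<partial>lborel) = 0"
    by (subst (asm) nn_integral_sample_law_kernel[OF n \<sigma>, of ?G]) (simp_all add: not_less)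
  then have J: "AE y in lborel. ?J y = 0"
    by (subst (asm) nn_integral_0_iff_AE) simp_all
  have J_nonzero: "?J y \<noteq> 0" if "y \<in> U" for y
  proof
    assume "?J y = 0"
    then have "AE t in lborel. ennreal (?G ((norm y)\<^sup>2) (\<sigma>\<^sup>2 * t) * cosh_kernel n \<theta> \<sigma> y t) = 0"
      by (subst (asm) nn_integral_0_iff_AE) simp_all
    then have "AE t::real in lborel. t \<notin> {0<..}"
    proof eventually_elim
      case (elim t)
      have "0 < ?G ((norm y)\<^sup>2) (\<sigma>\<^sup>2 * t) * cosh_kernel n \<theta> \<sigma> y t" if "0 < t"
        using that \<sigma> \<open>y \<in> U\<close> cosh_kernel_pos[OF n that, of \<theta> \<sigma> y] by (simp add: U_def)
      with elim show ?case
        by (auto simp: ennreal_eq_0_iff)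
    qed
    then show False
      using open_AE_lborel_notin[of "{0::real<..}"] by (simp add: greaterThan_non_empty)
  qed
  from J have "AE y in lborel. y \<notin> U"
    by eventually_elim (use J_nonzero in blast)
  moreover have "open U"
  proof -
    have "continuous_on (- {0}) (\<lambda>y::real^'p. b ((norm y)\<^sup>2))"
      by (rule continuous_on_compose2[OF cont]) (auto intro!: continuous_intros)
    then have "open ((\<lambda>y::real^'p. b ((norm y)\<^sup>2)) -` {c0<..} \<inter> - {0})"
      by (subst (asm) continuous_on_open_vimage) auto
    moreover have "(\<lambda>y::real^'p. b ((norm y)\<^sup>2)) -` {c0<..} \<inter> - {0} = U"
      by (auto simp: U_def)
    ultimately show ?thesis by simp
  qed
  ultimately have "U = {}"
    by (intro open_AE_lborel_notin)
  moreover have "sqrt w *\<^sub>R axis k 1 \<in> U" for k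
    using w by (simp add: U_def norm_axis_1 axis_eq_0_iff)
  ultimately show False
    by blast
qed

section \<open>Continuity and sign of \<open>a_fun\<close>\<close>

text \<open>Near a given point the tail integral is a constant minus an indefinite integral over a
  compact interval, which is continuous.\<close>

lemma continuous_on_integral_atLeast:
  fixes f :: "real \<Rightarrow> real"
  assumes cont: "continuous_on {c<..} f" and int: "\<And>w. c < w \<Longrightarrow> f integrable_on {w..}"
  shows "continuous_on {c<..} (\<lambda>w. integral {w..} f)"
proof (rule continuous_at_imp_continuous_on, intro ballI)
  fix w assume "w \<in> {c<..}"
  define u v where "u = (c + w) / 2" and "v = w + 1"
  have uv: "c < u" "u < w" "w < v"
    using \<open>w \<in> {c<..}\<close> by (simp_all add: u_def v_def)
  have f: "f integrable_on {u..v}"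
    using uv by (intro integrable_continuous_interval continuous_on_subset[OF cont]) auto
  have split: "integral {x..} f = integral {u..} f - integral {u..x} f" if "x \<in> {u..v}" for x
  proof -
    have "(f has_integral (integral {u..x} f + integral {x..} f)) ({u..x} \<union> {x..})"
    proof (rule has_integral_Un)
      show "(f has_integral integral {u..x} f) {u..x}"
        using that by (intro integrable_integral integrable_on_subinterval[OF f]) auto
      show "(f has_integral integral {x..} f) {x..}"
        using that uv by (intro integrable_integral int) auto
      have "{u..x} \<inter> {x..} = {x}"
        using that by auto
      then show "negligible ({u..x} \<inter> {x..})"
        by (simp only: negligible_sing)
    qed
    moreover have "{u..x} \<union> {x..} = {u..}"
      using that by auto
    ultimately have "integral {u..} f = integral {u..x} f + integral {x..} f"
      by (simp only: integral_unique)
    then show ?thesis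
      by linarith
  qed
  have "continuous_on {u..v} (\<lambda>x. integral {u..} f - integral {u..x} f)"
    by (intro continuous_intros indefinite_integral_continuous_1 f)
  then have "continuous_on {u..v} (\<lambda>x. integral {x..} f)"
    by (rule continuous_on_eq) (rule split[symmetric])
  then show "isCont (\<lambda>w. integral {w..} f) w"
    by (rule continuous_on_interior) (use uv in auto)
qed

lemma continuous_on_a_fun:
  assumes "\<And>w. 0 < w \<Longrightarrow> \<phi> differentiable at w" "continuous_on {0<..} (deriv \<phi>)"
    and "\<And>w. 0 < w \<Longrightarrow> g_integrand p n \<phi> integrable_on {w..}"
  shows "continuous_on {0<..} (a_fun p n \<phi>)"
proof -
  have \<phi>: "continuous_on {0<..} \<phi>"
    using assms(1)
    by (intro continuous_at_imp_continuous_on ballI differentiable_imp_continuous_within) simp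
  have "continuous_on {0<..} (g_integrand p n \<phi>)"
    unfolding g_integrand_def h_fun_def by (intro continuous_intros \<phi> assms(2)) simp_all
  from continuous_on_integral_atLeast[OF this assms(3)]
  have "continuous_on {0<..} (\<lambda>w. integral {w..} (g_integrand p n \<phi>))"
    by simp
  then show ?thesis
    unfolding a_fun_def g_fun_def by (intro continuous_intros \<phi>) simp_all
qed

text \<open>Intermediate values: a change of sign on a connected set would produce a zero.\<close>

lemma continuous_on_pos_if_nonzero:
  fixes f :: "real \<Rightarrow> real"
  assumes "continuous_on S f" "connected S" "\<And>x. x \<in> S \<Longrightarrow> f x \<noteq> 0" "x0 \<in> S" "0 < f x0" "x \<in> S"
  shows "0 < f x"
proof (rule ccontr)
  assume "\<not> 0 < f x"
  then have "f x \<le> 0" "0 \<le> f x0"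
    using \<open>0 < f x0\<close> by simp_all
  moreover have "connected (f ` S)"
    by (rule connected_continuous_image[OF assms(1,2)])
  ultimately have "0 \<in> f ` S"
    using \<open>x0 \<in> S\<close> \<open>x \<in> S\<close> by (blast intro: connectedD_interval)
  then show False
    using assms(3) by auto
qed

text \<open>Only the junk values \<open>0 powr _ = 0\<close> and \<open>_ / 0 = 0\<close> are involved; this covers the sample points with \<open>X = 0\<close>.\<close>

lemma a_fun_0: "1 \<le> n \<Longrightarrow> a_fun p n \<phi> 0 = 0"
  by (simp add: a_fun_def g_fun_def)

section \<open>Comparison of the two estimators\<close>

theorem theorem2:
  fixes \<phi> :: "real \<Rightarrow> real" and n :: nat and w0 :: real
    and \<delta> :: "(real^'p) \<times> real \<Rightarrow> real^'p" and p :: nat and \<alpha> :: real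
  assumes p: "p = CARD('p)" "3 \<le> p"
    and n: "1 \<le> n"
    and \<delta>: "\<delta> = shrinkage \<phi>"
    and \<alpha>: "\<alpha> = alpha n \<delta>"
    and phi_diff: "\<And>w. 0 < w \<Longrightarrow> \<phi> differentiable at w"
    and phi_deriv_cont: "continuous_on {0<..} (deriv \<phi>)"
    and g_finite: "\<And>w. 0 < w \<Longrightarrow> g_integrand p n \<phi> integrable_on {w..}"
    and a_nonzero: "\<And>w. 0 < w \<Longrightarrow> a_fun p n \<phi> w \<noteq> 0"
    and delta_improves: "improves_on (mse n \<delta>) (mse n (fst :: (real^'p) \<times> real \<Rightarrow> real^'p))"
    and max_at_0: "\<And>\<theta> \<sigma>. 0 < \<sigma> \<Longrightarrow> risk_reduction n \<delta> \<theta> \<sigma> / \<sigma>\<^sup>2 \<le> \<alpha>"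
    and w0: "solves_W_equation p n \<phi> \<alpha> w0"
    and a_beyond_w0: "\<And>w. w0 < w \<Longrightarrow> a_fun p n \<phi> w \<le> a_fun p n \<phi> w0"
    and psi1_nontrivial: "\<exists>w>0. psi1 p n \<phi> \<alpha> w0 w < 1"
  shows "improves_on
           (risk_of_reduction_estimator n \<delta> (reduction_est n \<phi> (psi1 p n \<phi> \<alpha> w0)))
           (risk_of_reduction_estimator n \<delta> (reduction_est0 n \<phi>))"

proof -
  define a0 where "a0 = a_fun p n \<phi> w0"
  \<comment> \<open>Continuity of \<open>a_fun\<close> is known only on the positive half-line; the
    extension by 0 makes \<open>b\<close> Borel on all of the reals and agrees with
    \<open>a_fun_0\<close> at 0.\<close>
  define b where "b w = (if w \<in> {0<..} then real p / real n * a_fun p n \<phi> w else 0)" for w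
  define c0 where "c0 = real p / real n * a0"
  have p0: "0 < real p" and n0: "0 < real n"
    using p n by auto
  have w0_pos: "0 < w0"
    and w0_eq: "(1 + w0) / a0 = real (p * (n + p + 2)) / real n * (1 / \<alpha>)"
    using w0 by (simp_all add: solves_W_equation_def a0_def)
  \<comment> \<open>At a parameter of strict improvement the risk is finite and the risk reduction
    positive; \<open>max_at_0\<close> bounds their ratio to \<open>\<sigma>\<^sup>2\<close> by
    \<open>\<alpha>\<close>.\<close>
  have \<alpha>_pos: "0 < \<alpha>"
  proof -
    obtain \<theta> :: "real^'p" and \<sigma> where \<sigma>: "0 < \<sigma>" and "mse n \<delta> \<theta> \<sigma> < mse n fst \<theta> \<sigma>"
      using delta_improves by (auto simp: improves_on_def)
    then have less: "mse n \<delta> \<theta> \<sigma> < ennreal (real CARD('p) * \<sigma>\<^sup>2)"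
      by (simp only: mse_fst[OF n \<sigma>])
    have "enn2real (mse n \<delta> \<theta> \<sigma>) < real CARD('p) * \<sigma>\<^sup>2"
      using less by (cases "mse n \<delta> \<theta> \<sigma>") (auto simp: ennreal_less_iff)
    then have "0 < risk_reduction n \<delta> \<theta> \<sigma> / \<sigma>\<^sup>2"
      using \<sigma> by (simp add: risk_reduction_def)
    then show ?thesis
      using max_at_0[OF \<sigma>, of \<theta>] by linarith
  qed
  have a0_nonzero: "a0 \<noteq> 0"
    using a_nonzero[OF w0_pos] by (simp add: a0_def)
  have a0_eq: "a0 = real n / real p * ((1 + w0) / real (n + p + 2)) * \<alpha>"
  proof -
    define N where "N = real (n + p + 2)"
    have "0 < N" and "(1 + w0) / a0 = real p * N / real n * (1 / \<alpha>)"
      using w0_eq by (simp_all only: N_def of_nat_mult of_nat_0_less_iff)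
    then show ?thesis
      unfolding N_def[symmetric] using a0_nonzero \<alpha>_pos p0 n0 by (simp add: field_simps)
  qed
  have a0_pos: "0 < a0"
    unfolding a0_eq using \<alpha>_pos p0 n0 w0_pos by (intro mult_pos_pos divide_pos_pos) auto
  have c0_pos: "0 < c0"
    using a0_pos p0 n0 by (simp add: c0_def)
  have a_cont: "continuous_on {0<..} (a_fun p n \<phi>)"
    by (rule continuous_on_a_fun[OF phi_diff phi_deriv_cont g_finite])
  have a_pos: "0 < a_fun p n \<phi> w" if "0 < w" for w
    by (rule continuous_on_pos_if_nonzero[OF a_cont])
      (use that a_nonzero w0_pos a0_pos in \<open>auto simp: a0_def\<close>)
  have b_cont: "continuous_on {0<..} b"
    by (rule continuous_on_eq[OF continuous_on_mult_left[OF a_cont, of "real p / real n"]])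
      (simp add: b_def)
  have b_meas [measurable]: "b \<in> borel_measurable borel"
    unfolding b_def
    by (intro borel_measurable_continuous_on_if continuous_on_mult_left[OF a_cont] continuous_on_const) simp
  have b_nonneg: "0 \<le> b w" for w
    using less_imp_le[OF a_pos[of w]] by (simp add: b_def)
  have b_le: "b w \<le> c0" if "w0 < w" for w
    using a_beyond_w0[OF that] p0 n0 w0_pos that
    by (simp add: b_def c0_def a0_def divide_right_mono mult_left_mono)
  have psi1_eq: "psi1 p n \<phi> \<alpha> w0 w = min 1 (a0 / a_fun p n \<phi> w)" for w
    by (simp add: psi1_def a0_eq)
  have est: "reduction_est n \<phi> (psi1 p n \<phi> \<alpha> w0) z = snd z * min (b (W_stat z)) c0"
    and est0: "reduction_est0 n \<phi> z = snd z * b (W_stat z)" if "0 < snd z" for z :: "(real^'p) \<times> real"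
  proof -
    let ?a = "a_fun p n \<phi> (W_stat z)"
    have W: "0 \<le> W_stat z"
      using that by (simp add: W_stat_def)
    have b_eq: "b (W_stat z) = real p / real n * ?a"
      using W a_fun_0[OF n, of p \<phi>] by (cases "W_stat z = 0") (auto simp: b_def)
    then show "reduction_est0 n \<phi> z = snd z * b (W_stat z)"
      by (simp add: reduction_est0_def p(1))
    \<comment> \<open>For \<open>W_stat z = 0\<close> both sides are 0, as \<open>?a\<close> is 0
      there and \<open>a0\<close> is positive.\<close>
    have "?a * min 1 (a0 / ?a) = min ?a a0"
      using W a_pos[of "W_stat z"] a_fun_0[OF n, of p \<phi>] a0_pos
      by (cases "W_stat z = 0") (auto simp: min_def field_simps)
    moreover have "min (b (W_stat z)) c0 = real p / real n * min ?a a0"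
      unfolding b_eq c0_def using p0 n0 by (subst min_mult_distrib_left) auto
    ultimately show "reduction_est n \<phi> (psi1 p n \<phi> \<alpha> w0) z = snd z * min (b (W_stat z)) c0"
      by (simp add: reduction_est_def psi1_eq p(1)[symmetric] mult.assoc)
  qed
  let ?T1 = "\<lambda>z::(real^'p) \<times> real. snd z * min (b (W_stat z)) c0"
  let ?T0 = "\<lambda>z::(real^'p) \<times> real. snd z * b (W_stat z)"
  let ?gap = "\<lambda>z::(real^'p) \<times> real. (snd z * (b (W_stat z) - min (b (W_stat z)) c0))\<^sup>2"
  have risk: "risk_of_reduction_estimator n \<delta> (reduction_est n \<phi> (psi1 p n \<phi> \<alpha> w0)) \<theta> \<sigma>
       = (\<integral>\<^sup>+ z. ennreal ((?T1 z - risk_reduction n \<delta> \<theta> \<sigma>)\<^sup>2) \<partial>sample_law n \<theta> \<sigma>)"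
    and risk0: "risk_of_reduction_estimator n \<delta> (reduction_est0 n \<phi>) \<theta> \<sigma>
       = (\<integral>\<^sup>+ z. ennreal ((?T0 z - risk_reduction n \<delta> \<theta> \<sigma>)\<^sup>2) \<partial>sample_law n \<theta> \<sigma>)"
    if "0 < \<sigma>" for \<theta> :: "real^'p" and \<sigma>
    unfolding risk_of_reduction_estimator_def using AE_sample_law_snd_pos[OF n that, of \<theta>]
    by (auto intro!: nn_integral_cong_AE simp: est est0 elim!: eventually_mono)
  have key: "(\<integral>\<^sup>+ z. ennreal ((?T1 z - risk_reduction n \<delta> \<theta> \<sigma>)\<^sup>2) \<partial>sample_law n \<theta> \<sigma>)
        + (\<integral>\<^sup>+ z. ennreal (?gap z) \<partial>sample_law n \<theta> \<sigma>)
      \<le> (\<integral>\<^sup>+ z. ennreal ((?T0 z - risk_reduction n \<delta> \<theta> \<sigma>)\<^sup>2) \<partial>sample_law n \<theta> \<sigma>)"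
    if \<sigma>: "0 < \<sigma>" for \<theta> :: "real^'p" and \<sigma>
  proof -
    \<comment> \<open>The defining equation of \<open>w0\<close>, rewritten so that
      \<open>max_at_0\<close> becomes the bound on \<open>R\<close> in
      \<open>truncation_inequality\<close>.\<close>
    have "c0 * (real (n + p + 2) / (1 + w0)) = \<alpha>"
      unfolding c0_def a0_eq using p0 n0 w0_pos by (simp del: of_nat_add)
    then have "\<alpha> * \<sigma>\<^sup>2 = c0 * (real (n + p + 2) / (1 + w0)) * \<sigma>\<^sup>2"
      by (simp only:)
    then have "\<alpha> * \<sigma>\<^sup>2 = c0 * \<sigma>\<^sup>2 * (real (n + CARD('p) + 2) / (1 + w0))"
      by (simp only: p(1) mult_ac)
    moreover have "risk_reduction n \<delta> \<theta> \<sigma> \<le> \<alpha> * \<sigma>\<^sup>2"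
      using max_at_0[OF \<sigma>, of \<theta>] \<sigma> by (simp add: field_simps)
    ultimately have "risk_reduction n \<delta> \<theta> \<sigma> \<le> c0 * \<sigma>\<^sup>2 * (real (n + CARD('p) + 2) / (1 + w0))"
      by simp
    from truncation_inequality[OF n \<sigma> c0_pos b_meas b_le this, of \<theta>] show ?thesis
      by (simp add: nn_integral_add)
  qed
  show ?thesis
    unfolding improves_on_def
  proof (intro conjI allI impI exI)
    fix \<theta> :: "real^'p" and \<sigma> :: real assume \<sigma>: "0 < \<sigma>"
    show "risk_of_reduction_estimator n \<delta> (reduction_est n \<phi> (psi1 p n \<phi> \<alpha> w0)) \<theta> \<sigma>
        \<le> risk_of_reduction_estimator n \<delta> (reduction_est0 n \<phi>) \<theta> \<sigma>"
      unfolding risk[OF \<sigma>] risk0[OF \<sigma>]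
      by (rule order_trans[OF _ key[OF \<sigma>]]) simp
  next
    \<comment> \<open>Strictness is shown at \<open>\<theta> = 0\<close>,
      \<open>\<sigma> = 1\<close>. The truncated estimator must have finite risk \<open>?r\<close>
      there, since adding a positive gap to an infinite value would not increase it.\<close>
    let ?R = "risk_reduction n \<delta> 0 1" and ?P = "sample_law n (0::real^'p) 1"
    let ?r = "\<integral>\<^sup>+ z. ennreal ((?T1 z - ?R)\<^sup>2) \<partial>?P"
    show "(0::real) < 1"
      by simp
    have "?r \<le> (\<integral>\<^sup>+ z. ennreal (2 * c0\<^sup>2 * (snd z)\<^sup>2 + 2 * ?R\<^sup>2) \<partial>?P)"
    proof (intro nn_integral_mono ennreal_leI)
      fix z :: "(real^'p) \<times> real"
      have "(?T1 z - ?R)\<^sup>2 \<le> 2 * (?T1 z)\<^sup>2 + 2 * ?R\<^sup>2"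
        using sum_squares_ge_zero[of "?T1 z + ?R" 0] by (simp add: power2_eq_square algebra_simps)
      moreover have "(min (b (W_stat z)) c0)\<^sup>2 \<le> c0\<^sup>2"
        using b_nonneg[of "W_stat z"] c0_pos by (intro power_mono) auto
      then have "(min (b (W_stat z)) c0)\<^sup>2 * (snd z)\<^sup>2 \<le> c0\<^sup>2 * (snd z)\<^sup>2"
        by (rule mult_right_mono) simp
      then have "(?T1 z)\<^sup>2 \<le> c0\<^sup>2 * (snd z)\<^sup>2"
        by (simp add: power_mult_distrib mult.commute)
      ultimately show "(?T1 z - ?R)\<^sup>2 \<le> 2 * c0\<^sup>2 * (snd z)\<^sup>2 + 2 * ?R\<^sup>2"
        by simp
    qed
    also have "\<dots> < \<infinity>"
      by (rule nn_integral_sample_law_snd_square_finite[OF n]) simp_all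
    finally have finite: "?r < \<infinity>" .
    \<comment> \<open>\<open>psi1 < 1\<close> at \<open>w\<close> means
      \<open>a0 / a_fun p n \<phi> w < 1\<close>, so truncation is active there.\<close>
    obtain w where w: "0 < w" "a0 < a_fun p n \<phi> w"
      using psi1_nontrivial a_pos by (auto simp: psi1_eq min_less_iff_disj)
    then have "c0 < b w"
      using p0 n0 by (simp add: b_def c0_def divide_strict_right_mono)
    then have "0 < (\<integral>\<^sup>+ z. ennreal (?gap z) \<partial>?P)"
      by (rule truncation_gap_pos[OF n zero_less_one b_meas b_cont w(1)])
    then have "?r < ?r + (\<integral>\<^sup>+ z. ennreal (?gap z) \<partial>?P)"
      using finite by (simp add: less_top)
    also have "\<dots> \<le> (\<integral>\<^sup>+ z. ennreal ((?T0 z - ?R)\<^sup>2) \<partial>?P)"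
      by (rule key) simp
    finally show "risk_of_reduction_estimator n \<delta> (reduction_est n \<phi> (psi1 p n \<phi> \<alpha> w0)) 0 1
        < risk_of_reduction_estimator n \<delta> (reduction_est0 n \<phi>) 0 1"
      unfolding risk[OF zero_less_one] risk0[OF zero_less_one] .
  qed
qed

end
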